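(* Let $(X,d)$ be a metric space, let $f_n:X\to X$, $n\ge 0$, be maps, and let $A=(a_{ij})_{N\times N}$ be a transition matrix. The following two statements are equivalent. (a) There exist sequences $\{V_{i,n}\}_{n=0}^{\infty}$, $1\le i\le N$, of nonempty compact subsets of $X$ with $V_{i,n}\cap V_{j,n}=\emptyset$ for all $1\le i\neq j\le N$ and $n\ge 0$, such that every $f_n$, $n\ge0$, is continuous in $E:=\bigcup_{n=0}^{\infty}\bigcup_{i=1}^{N}V_{i,n}$, and $V_\alpha^{m,n}:=\bigcap_{k=0}^{m}f_n^{-k}(V_{a_k,n+k})\neq\emptyset$ for all $m,n\ge0$ and all $\alpha=(a_0,a_1,\dots)\in\Sigma_N^+(A)$. (b) For every $n\ge0$ there exists a nonempty compact subset $\Lambda_n\subset X$ with $f_n(\Lambda_n)\subset\Lambda_{n+1}$, such that every $f_n$, $n\ge 0$, is continuous in $\bigcup_{k=0}^{\infty}\Lambda_k$ and the invariant subsystem of $x_{n+1}=f_n(x_n)$ on $\{\Lambda_n\}_{n=0}^\infty$ is topologically semiconjugate to $(\Sigma_N^+(A),\sigma_A)$.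
   Context: The maps $f_n$ define the non-autonomous discrete system $x_{n+1}=f_n(x_n)$, $n\ge0$. Notation: $f_i^n:=f_{i+n-1}\circ\cdots\circ f_i$ for $n\ge1$, $f_i^0$ is the identity, and $f_i^{-n}:=(f_i^n)^{-1}$ (preimage). A map is continuous in a set $S\subset X$ if its restriction to $S$ is continuous. A transition matrix is a matrix $A=(a_{ij})_{N\times N}$, $N\ge2$, with $a_{ij}\in\{0,1\}$, $\sum_{j=1}^N a_{ij}\ge1$ for all $i$ and $\sum_{i=1}^N a_{ij}\ge1$ for all $j$. $\Sigma_N^+(A):=\{s=(s_0,s_1,\dots):1\le s_j\le N,\ a_{s_js_{j+1}}=1,\ j\ge0\}$, with metric $\hat\rho(\alpha,\beta):=\sum_{i=0}^\infty \hat d(a_i,b_i)/2^i$ for $\alpha=(a_0,a_1,\dots)$, $\beta=(b_0,b_1,\dots)$, where $\hat d(a,b)=0$ if $a=b$ and $1$ otherwise. The subshift of finite type is $\sigma_A:\Sigma_N^+(A)\to\Sigma_N^+(A)$, $\sigma_A((s_0,s_1,s_2,\dots)):=(s_1,s_2,\dots)$. For subsets $\Lambda_n\subset X$ with $f_n(\Lambda_n)\subset\Lambda_{n+1}$ for all $n\ge0$, the system restricted to $\{\Lambda_n\}$ is called the invariant subsystem on $\{\Lambda_n\}_{n=0}^\infty$. It is topologically semiconjugate to $(\Sigma_N^+(A),\sigma_A)$ if for every $n\ge0$ there is a continuous surjective map $h_n:\Lambda_n\to\Sigma_N^+(A)$ with $h_{n+1}\circ f_n=\sigma_A\circ h_n$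 on $\Lambda_n$. *)

theory Defs
  imports "HOL-Analysis.Analysis"
begin

primrec iter_from :: "(nat \<Rightarrow> 'a \<Rightarrow> 'a) \<Rightarrow> nat \<Rightarrow> nat \<Rightarrow> 'a \<Rightarrow> 'a" where
  "iter_from f i 0 = id"
| "iter_from f i (Suc n) = f (i + n) \<circ> iter_from f i n"

text \<open>An \<open>N\<close> by \<open>N\<close> matrix is a function of two natural numbers; only its entries at indices
  in \<open>{1..N}\<close> are ever inspected.\<close>

definition transition_matrix :: "nat \<Rightarrow> (nat \<Rightarrow> nat \<Rightarrow> nat) \<Rightarrow> bool" where
  "transition_matrix N A \<longleftrightarrow>
     N \<ge> 2 \<and>
     (\<forall>i\<in>{1..N}. \<forall>j\<in>{1..N}. A i j \<in> {0, 1}) \<and>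
     (\<forall>i\<in>{1..N}. (\<Sum>j=1..N. A i j) \<ge> 1) \<and>
     (\<forall>j\<in>{1..N}. (\<Sum>i=1..N. A i j) \<ge> 1)"

definition subshift_space :: "nat \<Rightarrow> (nat \<Rightarrow> nat \<Rightarrow> nat) \<Rightarrow> (nat \<Rightarrow> nat) set" where
  "subshift_space N A = {s. \<forall>j. 1 \<le> s j \<and> s j \<le> N \<and> A (s j) (s (Suc j)) = 1}"

definition symbol_dist :: "nat \<Rightarrow> nat \<Rightarrow> real" where
  "symbol_dist a b = (if a = b then 0 else 1)"

definition seq_dist :: "(nat \<Rightarrow> nat) \<Rightarrow> (nat \<Rightarrow> nat) \<Rightarrow> real" where
  "seq_dist \<alpha> \<beta> = (\<Sum>i. symbol_dist (\<alpha> i) (\<beta> i) / 2 ^ i)"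

lemma summable_seq_dist: "summable (\<lambda>i. symbol_dist (\<alpha> i) (\<beta> i) / 2 ^ i)"
proof (rule summable_comparison_test')
  show "summable (\<lambda>i. (1/2::real) ^ i)"
    by (rule summable_geometric) simp
  show "norm (symbol_dist (\<alpha> i) (\<beta> i) / 2 ^ i) \<le> (1/2) ^ i" if "i \<ge> 0" for i
    by (simp add: symbol_dist_def power_divide)
qed

lemma Metric_space_subshift: "Metric_space (subshift_space N A) seq_dist"
proof
  fix \<alpha> \<beta> \<gamma> :: "nat \<Rightarrow> nat"
  show "0 \<le> seq_dist \<alpha> \<beta>"
    unfolding seq_dist_def
    by (rule suminf_nonneg[OF summable_seq_dist]) (simp add: symbol_dist_def)
  show "seq_dist \<alpha> \<beta> = seq_dist \<beta> \<alpha>"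
    by (simp add: seq_dist_def symbol_dist_def eq_commute)
  show "seq_dist \<alpha> \<beta> = 0 \<longleftrightarrow> \<alpha> = \<beta>"
    unfolding seq_dist_def
    by (subst suminf_eq_zero_iff[OF summable_seq_dist])
      (auto simp: symbol_dist_def fun_eq_iff split: if_splits)
  show "seq_dist \<alpha> \<gamma> \<le> seq_dist \<alpha> \<beta> + seq_dist \<beta> \<gamma>"
    unfolding seq_dist_def suminf_add[OF summable_seq_dist summable_seq_dist]
    by (intro suminf_le summable_add summable_seq_dist)
      (auto simp: symbol_dist_def field_simps)
qed

definition subshift_topology :: "nat \<Rightarrow> (nat \<Rightarrow> nat \<Rightarrow> nat) \<Rightarrow> (nat \<Rightarrow> nat) topology" where
  "subshift_topology N A = Metric_space.mtopology (subshift_space N A) seq_dist"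

definition shift :: "(nat \<Rightarrow> nat) \<Rightarrow> nat \<Rightarrow> nat" where
  "shift s = (\<lambda>j. s (Suc j))"

lemma shift_in_subshift_space: "s \<in> subshift_space N A \<Longrightarrow> shift s \<in> subshift_space N A"
  by (simp add: subshift_space_def shift_def)

text \<open>Only meaningful for an invariant family, i.e. when \<open>f n ` \<Lambda> n \<subseteq> \<Lambda> (Suc n)\<close> for all \<open>n\<close>.\<close>

definition semiconjugate_to_subshift ::
    "(nat \<Rightarrow> 'a::metric_space \<Rightarrow> 'a) \<Rightarrow> (nat \<Rightarrow> 'a set) \<Rightarrow> nat \<Rightarrow> (nat \<Rightarrow> nat \<Rightarrow> nat) \<Rightarrow> bool" where
  "semiconjugate_to_subshift f \<Lambda> N A \<longleftrightarrow>
     (\<exists>h :: nat \<Rightarrow> 'a \<Rightarrow> nat \<Rightarrow> nat. \<forall>n.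
        continuous_map (top_of_set (\<Lambda> n)) (subshift_topology N A) (h n) \<and>
        h n ` \<Lambda> n = subshift_space N A \<and>
        (\<forall>x\<in>\<Lambda> n. h (Suc n) (f n x) = shift (h n x)))"

end

theory Submission
  imports Defs
begin

text \<open>For (a) to (b), \<open>\<Lambda> n\<close> consists of the points whose orbit from time \<open>n\<close> runs through the sets
  \<open>V i (n + k)\<close> along an admissible sequence of symbols, and \<open>h n\<close> reads off this itinerary. Finitely
  many constraints cut out a compact set, so Cantor's intersection theorem gives a point for every
  infinite itinerary; disjointness of the compact sets makes each symbol locally constant.
  For (b) to (a), \<open>V i n\<close> is the preimage of the cylinder \<open>s\<^sub>0 = i\<close> under \<open>h n\<close>, which is clopen
  in \<open>\<Lambda> n\<close>.\<close>

section \<open>Compactness of the sets of points with prescribed itineraries\<close>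

text \<open>The recursion of \<open>iter_from\<close> adds the last map; splitting off the first one
  instead is what matches the shift.\<close>

lemma iter_from_Suc_left: "iter_from f n (Suc k) x = iter_from f (Suc n) k (f n x)"
  by (induction k) auto

text \<open>The maps are continuous only in \<open>E\<close>, so each point to which a map is
  applied must lie in \<open>E\<close>; the final point, at time \<open>k\<close>, need not.\<close>

lemma continuous_on_iter_from:
  assumes "\<And>m. continuous_on E (f m)"
    and "\<And>j x. j < k \<Longrightarrow> x \<in> S \<Longrightarrow> iter_from f n j x \<in> E"
  shows "continuous_on S (iter_from f n k)"
  using assms(2)
proof (induction k)
  case 0
  then show ?case by (simp add: continuous_on_id id_def)
next
  case (Suc k)
  have "continuous_on S (iter_from f n k)"
    using Suc by simp
  moreover have "continuous_on (iter_from f n k ` S) (f (n + k))"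
    by (rule continuous_on_subset[OF assms(1)]) (use Suc.prems in auto)
  ultimately show ?case
    by (simp add: continuous_on_compose del: o_apply)
qed

lemma compact_continuous_preimage_closed:
  fixes g :: "'a::metric_space \<Rightarrow> 'b::topological_space"
  assumes "compact S" "continuous_on S g" "closed T"
  shows "compact (S \<inter> g -` T)"
proof -
  have "closed (S \<inter> g -` T)"
    using assms by (intro continuous_closed_preimage compact_imp_closed)
  then have "compact (S \<inter> (S \<inter> g -` T))"
    by (rule compact_Int_closed[OF assms(1)])
  then show ?thesis by simp
qed

text \<open>The constraints are pulled back one map at a time: after \<open>C 0\<close>, what
  remains is a shorter itinerary of \<open>f n x\<close> starting at time \<open>Suc n\<close>.
  Hence the induction varies \<open>n\<close> and \<open>C\<close>.\<close>

lemma compact_finite_itinerary: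
  fixes f :: "nat \<Rightarrow> 'a::metric_space \<Rightarrow> 'a"
  assumes cont: "\<And>m. continuous_on E (f m)"
    and "\<And>k. compact (C k)" "\<And>k. C k \<subseteq> E"
  shows "compact {x. \<forall>k\<le>m. iter_from f n k x \<in> C k}"
  using assms(2,3)
proof (induction m arbitrary: n C)
  case 0
  then show ?case by simp
next
  case (Suc m)
  let ?T = "{x. \<forall>k\<le>m. iter_from f (Suc n) k x \<in> C (Suc k)}"
  have "{x. \<forall>k\<le>Suc m. iter_from f n k x \<in> C k} = C 0 \<inter> f n -` ?T"
  proof (intro set_eqI iffI)
    fix x assume x: "x \<in> {x. \<forall>k\<le>Suc m. iter_from f n k x \<in> C k}"
    then have "iter_from f n 0 x \<in> C 0" "\<forall>k\<le>m. iter_from f n (Suc k) x \<in> C (Suc k)" by blast+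
    then show "x \<in> C 0 \<inter> f n -` ?T" by (simp add: iter_from_Suc_left del: iter_from.simps(2))
  next
    fix x assume x: "x \<in> C 0 \<inter> f n -` ?T"
    have "iter_from f n k x \<in> C k" if "k \<le> Suc m" for k
      using x that by (cases k) (auto simp: iter_from_Suc_left simp del: iter_from.simps(2))
    then show "x \<in> {x. \<forall>k\<le>Suc m. iter_from f n k x \<in> C k}" by blast
  qed
  moreover have "closed ?T"
    by (intro compact_imp_closed Suc.IH Suc.prems)
  moreover have "continuous_on (C 0) (f n)"
    using cont Suc.prems(2) continuous_on_subset by blast
  ultimately show ?case
    by (simp only: compact_continuous_preimage_closed[OF Suc.prems(1)])
qed

lemma compact_itinerary:
  fixes f :: "nat \<Rightarrow> 'a::metric_space \<Rightarrow> 'a"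
  assumes "\<And>m. continuous_on E (f m)" "\<And>k. compact (C k)" "\<And>k. C k \<subseteq> E"
  shows "compact {x. \<forall>k. iter_from f n k x \<in> C k}"
proof -
  let ?K = "\<lambda>m. {x. \<forall>k\<le>m. iter_from f n k x \<in> C k}"
  have K: "compact (?K m)" for m
    by (rule compact_finite_itinerary[OF assms])
  \<comment> \<open>\<open>?K 0\<close> already occurs in the intersection; it is repeated to supply
    the compact factor.\<close>
  have "compact (?K 0 \<inter> (\<Inter>m. ?K m))"
    by (intro compact_Int_closed closed_INT ballI K compact_imp_closed)
  moreover have "?K 0 \<inter> (\<Inter>m. ?K m) = {x. \<forall>k. iter_from f n k x \<in> C k}"
    by blast
  ultimately show ?thesis by simp
qed

text \<open>The sets \<open>?K m\<close> decrease in \<open>m\<close>, so a finite intersection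
  contains the one with the largest index, and Cantor's intersection theorem applies.\<close>

lemma itinerary_nonempty:
  fixes f :: "nat \<Rightarrow> 'a::metric_space \<Rightarrow> 'a"
  assumes "\<And>m. continuous_on E (f m)" "\<And>k. compact (C k)" "\<And>k. C k \<subseteq> E"
    and "\<And>m. {x. \<forall>k\<le>m. iter_from f n k x \<in> C k} \<noteq> {}"
  shows "{x. \<forall>k. iter_from f n k x \<in> C k} \<noteq> {}"
proof -
  let ?K = "\<lambda>m. {x. \<forall>k\<le>m. iter_from f n k x \<in> C k}"
  have K: "compact (?K m)" for m
    by (rule compact_finite_itinerary[OF assms(1-3)])
  have "?K 0 \<inter> (\<Inter>m. ?K m) \<noteq> {}"
  proof (rule compact_imp_fip_image)
    fix I :: "nat set" assume "finite I"
    then have "\<And>m. m \<in> I \<Longrightarrow> m \<le> Max (insert 0 I)" by simp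
    \<comment> \<open>Inserting 0 keeps the maximum meaningful when \<open>I\<close> is
      empty.\<close>
    then have "?K (Max (insert 0 I)) \<subseteq> ?K 0 \<inter> (\<Inter>m\<in>I. ?K m)"
      using order_trans by blast
    then show "?K 0 \<inter> (\<Inter>m\<in>I. ?K m) \<noteq> {}"
      using assms(4)[of "Max (insert 0 I)"] by blast
  qed (use K compact_imp_closed in blast)+
  then show ?thesis by auto
qed

section \<open>The topology of the subshift in terms of cylinders\<close>

text \<open>A disagreement at \<open>k\<close> alone contributes \<open>1 / 2 ^ k\<close> to the
  distance.\<close>

lemma seq_dist_less_imp_eq:
  assumes "seq_dist \<alpha> \<beta> < 1 / 2 ^ k"
  shows "\<alpha> k = \<beta> k"
proof (rule ccontr)
  assume "\<alpha> k \<noteq> \<beta> k"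
  then have "1 / 2 ^ k = sum (\<lambda>i. symbol_dist (\<alpha> i) (\<beta> i) / 2 ^ i) {k}"
    by (simp add: symbol_dist_def)
  also have "\<dots> \<le> seq_dist \<alpha> \<beta>"
    unfolding seq_dist_def
    by (rule sum_le_suminf[OF summable_seq_dist]) (auto simp: symbol_dist_def)
  finally show False using assms by simp
qed

text \<open>Only the tail from \<open>m\<close> on contributes, and a geometric series bounds
  it.\<close>

lemma seq_dist_le_of_prefix_eq:
  assumes "\<And>k. k < m \<Longrightarrow> \<alpha> k = \<beta> k"
  shows "seq_dist \<alpha> \<beta> \<le> 2 / 2 ^ m"
proof -
  have "seq_dist \<alpha> \<beta> = (\<Sum>i. symbol_dist (\<alpha> (i + m)) (\<beta> (i + m)) / 2 ^ (i + m))
      + (\<Sum>i<m. symbol_dist (\<alpha> i) (\<beta> i) / 2 ^ i)"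
    unfolding seq_dist_def by (rule suminf_split_initial_segment[OF summable_seq_dist])
  also have "(\<Sum>i<m. symbol_dist (\<alpha> i) (\<beta> i) / 2 ^ i) = 0"
    using assms by (simp add: symbol_dist_def)
  also have "(\<Sum>i. symbol_dist (\<alpha> (i + m)) (\<beta> (i + m)) / 2 ^ (i + m))
      \<le> (\<Sum>i. (1 / 2) ^ i * (1 / 2 ^ m))"
  proof (rule suminf_le)
    show "summable (\<lambda>i. symbol_dist (\<alpha> (i + m)) (\<beta> (i + m)) / 2 ^ (i + m))"
      by (rule summable_ignore_initial_segment[OF summable_seq_dist])
    show "summable (\<lambda>i. (1 / 2) ^ i * (1 / 2 ^ m :: real))"
      by (intro summable_mult2 summable_geometric) simp
  qed (simp add: symbol_dist_def power_add power_divide)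
  also have "(\<Sum>i. (1 / 2) ^ i * (1 / 2 ^ m :: real)) = 2 / 2 ^ m"
    by (subst suminf_mult2[symmetric]) (simp_all add: summable_geometric suminf_geometric)
  finally show ?thesis by simp
qed

lemma topspace_subshift_topology [simp]: "topspace (subshift_topology N A) = subshift_space N A"
  unfolding subshift_topology_def
  by (rule Metric_space.topspace_mtopology[OF Metric_space_subshift])

text \<open>Balls and cylinders are nested in each other by the two preceding estimates. From here
  on the topology is handled through coordinates, without the metric.\<close>

lemma openin_subshift_topology_iff:
  "openin (subshift_topology N A) U \<longleftrightarrow>
     U \<subseteq> subshift_space N A \<and>
     (\<forall>\<alpha>\<in>U. \<exists>m. \<forall>\<beta>\<in>subshift_space N A. (\<forall>k<m. \<alpha> k = \<beta> k) \<longrightarrow> \<beta> \<in> U)"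
proof -
  interpret Metric_space "subshift_space N A" seq_dist
    by (rule Metric_space_subshift)
  have "(\<exists>r>0. mball \<alpha> r \<subseteq> U) \<longleftrightarrow>
      (\<exists>m. \<forall>\<beta>\<in>subshift_space N A. (\<forall>k<m. \<alpha> k = \<beta> k) \<longrightarrow> \<beta> \<in> U)"
    if \<alpha>: "\<alpha> \<in> subshift_space N A" for \<alpha>
  proof
    assume "\<exists>r>0. mball \<alpha> r \<subseteq> U"
    then obtain r where r: "r > 0" "mball \<alpha> r \<subseteq> U" by blast
    \<comment> \<open>With this \<open>m\<close>, the bound \<open>2 / 2 ^ m\<close> for a common
      prefix of length \<open>m\<close> falls below \<open>r\<close>.\<close>
    obtain m where m: "(1 / 2) ^ m < r / 2"
      using real_arch_pow_inv[of "r / 2" "1 / 2"] r(1) by auto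
    have "\<beta> \<in> U" if "\<beta> \<in> subshift_space N A" "\<forall>k<m. \<alpha> k = \<beta> k" for \<beta>
    proof -
      have "seq_dist \<alpha> \<beta> < r"
        using seq_dist_le_of_prefix_eq[of m \<alpha> \<beta>] that(2) m by (simp add: power_divide)
      then show ?thesis using r(2) \<alpha> that(1) by auto
    qed
    then show "\<exists>m. \<forall>\<beta>\<in>subshift_space N A. (\<forall>k<m. \<alpha> k = \<beta> k) \<longrightarrow> \<beta> \<in> U" by blast
  next
    assume "\<exists>m. \<forall>\<beta>\<in>subshift_space N A. (\<forall>k<m. \<alpha> k = \<beta> k) \<longrightarrow> \<beta> \<in> U"
    then obtain m where m: "\<And>\<beta>. \<beta> \<in> subshift_space N A \<Longrightarrow> \<forall>k<m. \<alpha> k = \<beta> k \<Longrightarrow> \<beta> \<in> U"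
      by blast
    have "\<beta> \<in> U" if "\<beta> \<in> mball \<alpha> (1 / 2 ^ m)" for \<beta>
    proof (rule m)
      show "\<beta> \<in> subshift_space N A" using that by simp
      have "seq_dist \<alpha> \<beta> < 1 / 2 ^ k" if "k < m" for k
      proof -
        have "(1::real) / 2 ^ m \<le> 1 / 2 ^ k"
          using that by (intro divide_left_mono power_increasing) auto
        then show ?thesis using \<open>\<beta> \<in> mball \<alpha> (1 / 2 ^ m)\<close> by auto
      qed
      then show "\<forall>k<m. \<alpha> k = \<beta> k" using seq_dist_less_imp_eq by blast
    qed
    then show "\<exists>r>0. mball \<alpha> r \<subseteq> U" by (intro exI[of _ "1 / 2 ^ m"]) auto
  qed
  then show ?thesis
    unfolding subshift_topology_def openin_mtopology by blast
qed

text \<open>A neighbourhood in the subshift fixes only finitely many coordinates, so continuity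
  means that each symbol of \<open>h x\<close> is locally constant in \<open>x\<close>.\<close>

lemma continuous_map_subshift_iff:
  "continuous_map X (subshift_topology N A) h \<longleftrightarrow>
     h ` topspace X \<subseteq> subshift_space N A \<and>
     (\<forall>k i. openin X {x \<in> topspace X. h x k = i})"
proof (intro iffI conjI allI)
  assume h: "continuous_map X (subshift_topology N A) h"
  then show sub: "h ` topspace X \<subseteq> subshift_space N A"
    using continuous_map_image_subset_topspace by fastforce
  fix k i
  have "openin (subshift_topology N A) {\<alpha> \<in> subshift_space N A. \<alpha> k = i}"
    unfolding openin_subshift_topology_iff by (auto intro!: exI[of _ "Suc k"])
  then have "openin X {x \<in> topspace X. h x \<in> {\<alpha> \<in> subshift_space N A. \<alpha> k = i}}"
    by (rule openin_continuous_map_preimage[OF h])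
  also have "{x \<in> topspace X. h x \<in> {\<alpha> \<in> subshift_space N A. \<alpha> k = i}} = {x \<in> topspace X. h x k = i}"
    using sub by auto
  finally show "openin X {x \<in> topspace X. h x k = i}" .
next
  assume h: "h ` topspace X \<subseteq> subshift_space N A \<and> (\<forall>k i. openin X {x \<in> topspace X. h x k = i})"
  show "continuous_map X (subshift_topology N A) h"
    unfolding continuous_map
  proof (intro conjI allI impI)
    show "h ` topspace X \<subseteq> topspace (subshift_topology N A)" using h by simp
    fix U assume U: "openin (subshift_topology N A) U"
    show "openin X {x \<in> topspace X. h x \<in> U}"
    proof (subst openin_subopen, intro ballI)
      fix x assume x: "x \<in> {x \<in> topspace X. h x \<in> U}"
      then obtain m where m: "\<And>\<beta>. \<beta> \<in> subshift_space N A \<Longrightarrow> \<forall>k<m. h x k = \<beta> k \<Longrightarrow> \<beta> \<in> U"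
        using U unfolding openin_subshift_topology_iff by blast
      \<comment> \<open>The factor \<open>topspace X\<close> matters for \<open>m = 0\<close>, where
        the indexed intersection is the whole type.\<close>
      let ?T = "topspace X \<inter> (\<Inter>k<m. {y \<in> topspace X. h y k = h x k})"
      have "openin X ?T"
        using h by (cases "m = 0") (auto intro!: openin_Int)
      moreover have "?T \<subseteq> {x \<in> topspace X. h x \<in> U}"
        using h m by auto
      ultimately show "\<exists>T. openin X T \<and> x \<in> T \<and> T \<subseteq> {x \<in> topspace X. h x \<in> U}"
        using x by blast
    qed
  qed
qed

section \<open>Admissible sequences with a given first symbol\<close>

lemma transition_matrix_successor:
  assumes "transition_matrix N A" "i \<in> {1..N}"
  shows "\<exists>j\<in>{1..N}. A i j = 1"
proof (rule ccontr)
  assume "\<not> ?thesis"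
  then have "\<forall>j\<in>{1..N}. A i j = 0"
    using assms unfolding transition_matrix_def by blast
  then have "(\<Sum>j=1..N. A i j) = 0" by simp
  then show False
    using assms unfolding transition_matrix_def by fastforce
qed

lemma subshift_space_start:
  assumes "transition_matrix N A" "i \<in> {1..N}"
  obtains \<alpha> where "\<alpha> \<in> subshift_space N A" "\<alpha> 0 = i"
proof -
  \<comment> \<open>Dependent choice yields some initial value satisfying \<open>P 0\<close>; the
    implication forces that value to be \<open>i\<close>.\<close>
  define P where "P k x \<longleftrightarrow> x \<in> {1..N} \<and> (k = 0 \<longrightarrow> x = i)" for k x :: nat
  have "\<exists>\<alpha>. \<forall>k. P k (\<alpha> k) \<and> A (\<alpha> k) (\<alpha> (Suc k)) = 1"
  proof (rule dependent_nat_choice)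
    show "\<exists>x. P 0 x" using assms(2) by (simp add: P_def)
    show "\<exists>y. P (Suc k) y \<and> A x y = 1" if "P k x" for k x
      using transition_matrix_successor[OF assms(1), of x] that by (auto simp: P_def)
  qed
  then obtain \<alpha> where "\<And>k. P k (\<alpha> k)" "\<And>k. A (\<alpha> k) (\<alpha> (Suc k)) = 1" by blast
  then show thesis
    by (intro that[of \<alpha>]) (auto simp: P_def subshift_space_def)
qed

section \<open>From itineraries to a semiconjugacy\<close>

lemma subshift_semiconjugacy_of_itineraries:
  fixes f :: "nat \<Rightarrow> 'a::metric_space \<Rightarrow> 'a"
  assumes A: "transition_matrix N A"
    and comp: "\<And>i n. i \<in> {1..N} \<Longrightarrow> compact (V i n)"
    and disj: "\<And>i j n. i \<in> {1..N} \<Longrightarrow> j \<in> {1..N} \<Longrightarrow> i \<noteq> j \<Longrightarrow> V i n \<inter> V j n = {}"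
    and cont: "\<And>n. continuous_on (\<Union>k. \<Union>i\<in>{1..N}. V i k) (f n)"
    and ne: "\<And>m n \<alpha>. \<alpha> \<in> subshift_space N A \<Longrightarrow>
      (\<Inter>k\<in>{0..m}. iter_from f n k -` V (\<alpha> k) (n + k)) \<noteq> {}"
  shows "\<exists>\<Lambda> :: nat \<Rightarrow> 'a set.
        (\<forall>n. \<Lambda> n \<noteq> {} \<and> compact (\<Lambda> n) \<and> f n ` \<Lambda> n \<subseteq> \<Lambda> (Suc n)) \<and>
        (\<forall>n. continuous_on (\<Union>k. \<Lambda> k) (f n)) \<and>
        semiconjugate_to_subshift f \<Lambda> N A"
proof -
  define E where "E = (\<Union>k. \<Union>i\<in>{1..N}. V i k)"
  define W where "W n = (\<Union>i\<in>{1..N}. V i n)" for n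
  \<comment> \<open>\<open>M n\<close> ignores the transition matrix. It is compact and carries the
    coding \<open>h n\<close>, so that \<open>\<Lambda> n\<close> can be cut out of it by closed
    conditions on symbols.\<close>
  define M where "M n = {x. \<forall>k. iter_from f n k x \<in> W (n + k)}" for n
  define \<Lambda> where "\<Lambda> n = {x. \<exists>\<alpha>\<in>subshift_space N A. \<forall>k. iter_from f n k x \<in> V (\<alpha> k) (n + k)}" for n
  \<comment> \<open>Disjointness makes the symbol unique, and on \<open>M n\<close> it exists;
    elsewhere the value may be arbitrary.\<close>
  define h where "h n x k = (THE i. i \<in> {1..N} \<and> iter_from f n k x \<in> V i (n + k))" for n x k
  have contE: "continuous_on E (f n)" for n
    using cont by (simp add: E_def)
  have W: "compact (W n)" "W n \<subseteq> E" for n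
    using comp by (auto simp: W_def E_def)
  have sym: "\<alpha> k \<in> {1..N}" "A (\<alpha> k) (\<alpha> (Suc k)) = 1" if "\<alpha> \<in> subshift_space N A" for \<alpha> k
    using that by (auto simp: subshift_space_def)
  have h_eqI: "h n x k = i" if "i \<in> {1..N}" "iter_from f n k x \<in> V i (n + k)" for n x k i
    unfolding h_def using that disj by (intro the_equality) blast+
  have h_eq: "h n x = \<alpha>" if "\<alpha> \<in> subshift_space N A" "\<forall>k. iter_from f n k x \<in> V (\<alpha> k) (n + k)" for n x \<alpha>
    using that sym h_eqI by blast
  have M_h: "h n x k \<in> {1..N}" "iter_from f n k x \<in> V (h n x k) (n + k)" if "x \<in> M n" for n x k
  proof -
    have "iter_from f n k x \<in> W (n + k)"
      using \<open>x \<in> M n\<close> by (simp add: M_def)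
    then obtain i where "i \<in> {1..N}" "iter_from f n k x \<in> V i (n + k)"
      unfolding W_def by blast
    then show "h n x k \<in> {1..N}" "iter_from f n k x \<in> V (h n x k) (n + k)"
      using h_eqI by auto
  qed
  have cont_iter: "continuous_on (M n) (iter_from f n k)" for n k
    by (rule continuous_on_iter_from[OF contE]) (use W(2) in \<open>auto simp: M_def\<close>)
  have M_compact: "compact (M n)" for n
    unfolding M_def by (rule compact_itinerary[OF contE]) (use W in auto)
  have closed_cyl: "closed {x \<in> M n. h n x k = i}" if "i \<in> {1..N}" for n k i
  proof -
    have "{x \<in> M n. h n x k = i} = M n \<inter> iter_from f n k -` V i (n + k)"
      using M_h(2) h_eqI that by auto
    then show ?thesis
      using continuous_closed_preimage[OF cont_iter] compact_imp_closed[OF M_compact]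
        compact_imp_closed[OF comp[OF that]]
      by simp
  qed
  have \<Lambda>_M: "\<Lambda> n \<subseteq> M n" for n
    unfolding \<Lambda>_def M_def W_def using sym(1) by blast
  \<comment> \<open>The only possible itinerary of \<open>x\<close> is \<open>h n x\<close>, which
    removes the existential quantifier over sequences.\<close>
  have \<Lambda>_iff: "x \<in> \<Lambda> n \<longleftrightarrow> x \<in> M n \<and> h n x \<in> subshift_space N A" for x n
  proof
    assume x: "x \<in> \<Lambda> n"
    then obtain \<alpha> where \<alpha>: "\<alpha> \<in> subshift_space N A" "\<forall>k. iter_from f n k x \<in> V (\<alpha> k) (n + k)"
      unfolding \<Lambda>_def by blast
    show "x \<in> M n \<and> h n x \<in> subshift_space N A"
      using x \<Lambda>_M h_eq[OF \<alpha>] \<alpha>(1) by blast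
  next
    assume "x \<in> M n \<and> h n x \<in> subshift_space N A"
    then show "x \<in> \<Lambda> n"
      unfolding \<Lambda>_def using M_h(2) by blast
  qed
  have \<Lambda>_h: "h n x \<in> subshift_space N A" if "x \<in> \<Lambda> n" for n x
    using that \<Lambda>_iff by blast
  have \<Lambda>_compact: "compact (\<Lambda> n)" for n
  proof -
    define P where "P = {(i, j). i \<in> {1..N} \<and> j \<in> {1..N} \<and> A i j = 1}"
    have "finite P"
      by (rule finite_subset[of _ "{1..N} \<times> {1..N}"]) (auto simp: P_def)
    \<comment> \<open>Admissibility is one condition for each \<open>k\<close>, and each is a finite
      union of closed sets over the allowed pairs of symbols.\<close>
    have "\<Lambda> n = M n \<inter> (\<Inter>k. \<Union>(i, j)\<in>P. {x \<in> M n. h n x k = i} \<inter> {x \<in> M n. h n x (Suc k) = j})"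
      unfolding set_eq_iff \<Lambda>_iff using M_h(1)
      by (fastforce simp: P_def subshift_space_def)
    moreover have "closed (\<Inter>k. \<Union>(i, j)\<in>P. {x \<in> M n. h n x k = i} \<inter> {x \<in> M n. h n x (Suc k) = j})"
      using \<open>finite P\<close>
      by (intro closed_INT ballI closed_UN) (auto simp: P_def intro!: closed_Int closed_cyl)
    ultimately show ?thesis
      using M_compact by (simp add: compact_Int_closed)
  qed
  have surj: "\<alpha> \<in> h n ` \<Lambda> n" if \<alpha>: "\<alpha> \<in> subshift_space N A" for \<alpha> n
  proof -
    have "{x. \<forall>k. iter_from f n k x \<in> V (\<alpha> k) (n + k)} \<noteq> {}"
    proof (rule itinerary_nonempty[OF contE])
      fix m
      show "{x. \<forall>k\<le>m. iter_from f n k x \<in> V (\<alpha> k) (n + k)} \<noteq> {}"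
      proof -
        have "(\<Inter>k\<in>{0..m}. iter_from f n k -` V (\<alpha> k) (n + k))
            = {x. \<forall>k\<le>m. iter_from f n k x \<in> V (\<alpha> k) (n + k)}"
          by auto
        then show ?thesis using ne[OF \<alpha>, of n m] by simp
      qed
    next
      show "compact (V (\<alpha> k) (n + k))" for k
        by (rule comp[OF sym(1)[OF \<alpha>]])
      show "V (\<alpha> k) (n + k) \<subseteq> E" for k
        unfolding E_def using sym(1)[OF \<alpha>] by blast
    qed
    then obtain x where x: "\<forall>k. iter_from f n k x \<in> V (\<alpha> k) (n + k)" by blast
    then have "x \<in> \<Lambda> n" using \<alpha> by (auto simp: \<Lambda>_def)
    then show ?thesis using h_eq[OF \<alpha> x] by blast
  qed
  have h_image: "h n ` \<Lambda> n = subshift_space N A" for n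
    using surj \<Lambda>_h by blast
  obtain \<alpha>\<^sub>0 where "\<alpha>\<^sub>0 \<in> subshift_space N A"
  proof (rule subshift_space_start[OF A])
    show "1 \<in> {1..N}" using A by (simp add: transition_matrix_def)
  qed
  then have \<Lambda>_ne: "\<Lambda> n \<noteq> {}" for n using surj by blast
  \<comment> \<open>The orbit of \<open>f n x\<close> is that of \<open>x\<close> without its first
    point; \<open>n + Suc k\<close> and \<open>Suc n + k\<close> name the same time.\<close>
  have shift_iter: "iter_from f (Suc n) k (f n x) \<in> V (shift \<alpha> k) (Suc n + k)"
    if "\<forall>k. iter_from f n k x \<in> V (\<alpha> k) (n + k)" for n k x \<alpha>
    using that[rule_format, of "Suc k"]
    by (simp add: iter_from_Suc_left shift_def del: iter_from.simps(2))
  have \<Lambda>_step: "f n x \<in> \<Lambda> (Suc n)" "h (Suc n) (f n x) = shift (h n x)" if "x \<in> \<Lambda> n" for n x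
  proof -
    obtain \<alpha> where \<alpha>: "\<alpha> \<in> subshift_space N A" "\<forall>k. iter_from f n k x \<in> V (\<alpha> k) (n + k)"
      using \<open>x \<in> \<Lambda> n\<close> by (auto simp: \<Lambda>_def)
    note s = shift_in_subshift_space[OF \<alpha>(1)] shift_iter[OF \<alpha>(2)]
    show "f n x \<in> \<Lambda> (Suc n)" using s unfolding \<Lambda>_def by blast
    show "h (Suc n) (f n x) = shift (h n x)"
      using h_eq[OF \<alpha>] h_eq[of "shift \<alpha>" "Suc n" "f n x"] s by simp
  qed
  have h_cont: "continuous_map (top_of_set (\<Lambda> n)) (subshift_topology N A) (h n)" for n
    unfolding continuous_map_subshift_iff
  proof (intro conjI allI)
    show "h n ` topspace (top_of_set (\<Lambda> n)) \<subseteq> subshift_space N A" using \<Lambda>_h by auto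
    fix k i
    \<comment> \<open>A level set is open because the finitely many other level sets are closed. For
      \<open>i\<close> outside \<open>{1..N}\<close> they cover \<open>M n\<close>, and the level
      set is empty.\<close>
    have "closed (\<Union>j\<in>{1..N} - {i}. {x \<in> M n. h n x k = j})"
      by (intro closed_UN) (auto intro: closed_cyl)
    moreover have "{x \<in> \<Lambda> n. h n x k = i} = \<Lambda> n \<inter> - (\<Union>j\<in>{1..N} - {i}. {x \<in> M n. h n x k = j})"
      using \<Lambda>_M M_h(1) by fastforce
    ultimately show "openin (top_of_set (\<Lambda> n)) {x \<in> topspace (top_of_set (\<Lambda> n)). h n x k = i}"
      by (simp only: topspace_euclidean_subtopology openin_open_Int open_Compl)
  qed
  have "\<Lambda> n \<subseteq> E" for n
  proof
    fix x assume "x \<in> \<Lambda> n"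
    then have "iter_from f n 0 x \<in> W (n + 0)" using \<Lambda>_M M_def by blast
    then show "x \<in> E" using W(2) by auto
  qed
  then have "continuous_on (\<Union>k. \<Lambda> k) (f n)" for n
    by (intro continuous_on_subset[OF contE]) auto
  moreover have "semiconjugate_to_subshift f \<Lambda> N A"
    unfolding semiconjugate_to_subshift_def
    using h_cont \<Lambda>_step(2) h_image by (intro exI[of _ h] conjI ballI allI) simp_all
  ultimately show ?thesis
    using \<Lambda>_ne \<Lambda>_compact \<Lambda>_step(1) by (intro exI[of _ \<Lambda>] conjI allI) auto
qed

section \<open>From a semiconjugacy to itineraries\<close>

lemma itineraries_of_subshift_semiconjugacy:
  fixes f :: "nat \<Rightarrow> 'a::metric_space \<Rightarrow> 'a"
  assumes A: "transition_matrix N A"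
    and comp: "\<And>n. compact (\<Lambda> n)" and inv: "\<And>n. f n ` \<Lambda> n \<subseteq> \<Lambda> (Suc n)"
    and cont: "\<And>n. continuous_on (\<Union>k. \<Lambda> k) (f n)"
    and semi: "semiconjugate_to_subshift f \<Lambda> N A"
  shows "\<exists>V :: nat \<Rightarrow> nat \<Rightarrow> 'a set.
        (\<forall>i\<in>{1..N}. \<forall>n. V i n \<noteq> {} \<and> compact (V i n)) \<and>
        (\<forall>i\<in>{1..N}. \<forall>j\<in>{1..N}. \<forall>n. i \<noteq> j \<longrightarrow> V i n \<inter> V j n = {}) \<and>
        (\<forall>n. continuous_on (\<Union>k. \<Union>i\<in>{1..N}. V i k) (f n)) \<and>
        (\<forall>m n. \<forall>\<alpha>\<in>subshift_space N A.
            (\<Inter>k\<in>{0..m}. iter_from f n k -` V (\<alpha> k) (n + k)) \<noteq> {})"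
proof -
  obtain h where h:
      "\<And>n. continuous_map (top_of_set (\<Lambda> n)) (subshift_topology N A) (h n)"
      "\<And>n. h n ` \<Lambda> n = subshift_space N A"
      "\<And>n x. x \<in> \<Lambda> n \<Longrightarrow> h (Suc n) (f n x) = shift (h n x)"
    using semi unfolding semiconjugate_to_subshift_def by metis
  define V where "V i n = {x \<in> \<Lambda> n. h n x 0 = i}" for i n
  have V_compact: "compact (V i n)" for i n
  proof -
    have "openin (top_of_set (\<Lambda> n)) {x \<in> \<Lambda> n. h n x 0 = j}" for j
      using h(1)[of n] unfolding continuous_map_subshift_iff by simp
    \<comment> \<open>Only unions of open sets are involved, so \<open>j\<close> may range over all
      natural numbers other than \<open>i\<close>; the complement \<open>V i n\<close> is closed in
      \<open>\<Lambda> n\<close>.\<close>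
    then have "openin (top_of_set (\<Lambda> n)) (\<Union>j\<in>- {i}. {x \<in> \<Lambda> n. h n x 0 = j})"
      by blast
    then have "closedin (top_of_set (\<Lambda> n)) (\<Lambda> n - (\<Union>j\<in>- {i}. {x \<in> \<Lambda> n. h n x 0 = j}))"
      by (metis closedin_diff closedin_topspace topspace_euclidean_subtopology)
    also have "\<Lambda> n - (\<Union>j\<in>- {i}. {x \<in> \<Lambda> n. h n x 0 = j}) = V i n"
      by (auto simp: V_def)
    finally show ?thesis
      using comp closedin_compact by blast
  qed
  have V_ne: "V i n \<noteq> {}" if i: "i \<in> {1..N}" for i n
  proof -
    \<comment> \<open>Every symbol begins an admissible sequence, and surjectivity of
      \<open>h n\<close> supplies a point coded by it.\<close>
    obtain \<alpha> where "\<alpha> \<in> subshift_space N A" "\<alpha> 0 = i"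
      using subshift_space_start[OF A i] .
    then show ?thesis using h(2)[of n] by (force simp: V_def)
  qed
  \<comment> \<open>Iterating the semiconjugacy drops \<open>k\<close> symbols; at
    \<open>j = 0\<close> this says that the point at time \<open>n + k\<close> lies in the cylinder
    of the symbol \<open>h n x k\<close>.\<close>
  have orbit: "iter_from f n k x \<in> \<Lambda> (n + k) \<and> (\<forall>j. h (n + k) (iter_from f n k x) j = h n x (k + j))"
    if "x \<in> \<Lambda> n" for n k x
  proof (induction k)
    case (Suc k)
    then show ?case using inv[of "n + k"] h(3)[of "iter_from f n k x" "n + k"]
      by (auto simp: shift_def)
  qed (use that in auto)
  have "(\<Inter>k\<in>{0..m}. iter_from f n k -` V (\<alpha> k) (n + k)) \<noteq> {}"
    if \<alpha>: "\<alpha> \<in> subshift_space N A" for m n \<alpha>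
  proof -
    \<comment> \<open>A point coded by the entire sequence \<alpha> meets the constraints for every
      \<open>m\<close> at once.\<close>
    obtain x where "x \<in> \<Lambda> n" "h n x = \<alpha>" using h(2)[of n] \<alpha> by (metis imageE)
    then have "x \<in> (\<Inter>k\<in>{0..m}. iter_from f n k -` V (\<alpha> k) (n + k))"
      using orbit[of x n] by (auto simp: V_def)
    then show ?thesis by blast
  qed
  moreover have "continuous_on (\<Union>k. \<Union>i\<in>{1..N}. V i k) (f n)" for n
    by (rule continuous_on_subset[OF cont]) (auto simp: V_def)
  moreover have "V i n \<inter> V j n = {}" if "i \<noteq> j" for i j n
    using that by (auto simp: V_def)
  ultimately show ?thesis
    using V_compact V_ne by (intro exI[of _ V] conjI ballI allI impI) simp_all
qed

theorem theorem3p1: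
  fixes f :: "nat \<Rightarrow> 'a::metric_space \<Rightarrow> 'a"
    and N :: nat
    and A :: "nat \<Rightarrow> nat \<Rightarrow> nat"
  assumes "transition_matrix N A"
  shows
    "(\<exists>V :: nat \<Rightarrow> nat \<Rightarrow> 'a set.
        (\<forall>i\<in>{1..N}. \<forall>n. V i n \<noteq> {} \<and> compact (V i n)) \<and>
        (\<forall>i\<in>{1..N}. \<forall>j\<in>{1..N}. \<forall>n. i \<noteq> j \<longrightarrow> V i n \<inter> V j n = {}) \<and>
        (\<forall>n. continuous_on (\<Union>k. \<Union>i\<in>{1..N}. V i k) (f n)) \<and>
        (\<forall>m n. \<forall>\<alpha>\<in>subshift_space N A.
            (\<Inter>k\<in>{0..m}. iter_from f n k -` V (\<alpha> k) (n + k)) \<noteq> {}))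
     \<longleftrightarrow>
     (\<exists>\<Lambda> :: nat \<Rightarrow> 'a set.
        (\<forall>n. \<Lambda> n \<noteq> {} \<and> compact (\<Lambda> n) \<and> f n ` \<Lambda> n \<subseteq> \<Lambda> (Suc n)) \<and>
        (\<forall>n. continuous_on (\<Union>k. \<Lambda> k) (f n)) \<and>
        semiconjugate_to_subshift f \<Lambda> N A)"
proof (rule iffI; elim exE conjE)
  fix V :: "nat \<Rightarrow> nat \<Rightarrow> 'a set"
  assume "\<forall>i\<in>{1..N}. \<forall>n. V i n \<noteq> {} \<and> compact (V i n)"
    "\<forall>i\<in>{1..N}. \<forall>j\<in>{1..N}. \<forall>n. i \<noteq> j \<longrightarrow> V i n \<inter> V j n = {}"
    "\<forall>n. continuous_on (\<Union>k. \<Union>i\<in>{1..N}. V i k) (f n)"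
    "\<forall>m n. \<forall>\<alpha>\<in>subshift_space N A. (\<Inter>k\<in>{0..m}. iter_from f n k -` V (\<alpha> k) (n + k)) \<noteq> {}"
  then show "\<exists>\<Lambda>. (\<forall>n. \<Lambda> n \<noteq> {} \<and> compact (\<Lambda> n) \<and> f n ` \<Lambda> n \<subseteq> \<Lambda> (Suc n)) \<and>
      (\<forall>n. continuous_on (\<Union>k. \<Lambda> k) (f n)) \<and> semiconjugate_to_subshift f \<Lambda> N A"
    by (intro subshift_semiconjugacy_of_itineraries[where V = V] assms) simp_all
next
  fix \<Lambda> :: "nat \<Rightarrow> 'a set"
  assume "\<forall>n. \<Lambda> n \<noteq> {} \<and> compact (\<Lambda> n) \<and> f n ` \<Lambda> n \<subseteq> \<Lambda> (Suc n)"
    "\<forall>n. continuous_on (\<Union>k. \<Lambda> k) (f n)" "semiconjugate_to_subshift f \<Lambda> N A"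
  then show "\<exists>V. (\<forall>i\<in>{1..N}. \<forall>n. V i n \<noteq> {} \<and> compact (V i n)) \<and>
      (\<forall>i\<in>{1..N}. \<forall>j\<in>{1..N}. \<forall>n. i \<noteq> j \<longrightarrow> V i n \<inter> V j n = {}) \<and>
      (\<forall>n. continuous_on (\<Union>k. \<Union>i\<in>{1..N}. V i k) (f n)) \<and>
      (\<forall>m n. \<forall>\<alpha>\<in>subshift_space N A.
          (\<Inter>k\<in>{0..m}. iter_from f n k -` V (\<alpha> k) (n + k)) \<noteq> {})"
    by (intro itineraries_of_subshift_semiconjugacy[where \<Lambda> = \<Lambda>] assms) simp_all
qed

end
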